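(* For every non-negative integer $m$ the following recursion formula holds (as an identity of meromorphic functions of $z\in\mathbb{C}$): $$W_{m+2}(z)+W_{m+4}(z)=\frac{4(m+2)(m+3)}{z^2}\big(W_{m+1}(z)-W_{m+3}(z)\big)-\frac{m+3}{m+1}\big(W_m(z)+W_{m+2}(z)\big),$$ where $W_m:=I_m'J_m-I_mJ_m'$.
   Context: For a non-negative integer $m$, $J_m$ is the Bessel function of the first kind: the entire function satisfying $J_m''(z)+\frac{1}{z}J_m'(z)-\left(\frac{m^2}{z^2}-1\right)J_m(z)=0$ and normalized by $J_m(z)=\frac{1}{m!}\left(\frac{z}{2}\right)^m+o(z^m)$ as $z\to 0$. $I_m$ is the modified Bessel function: the entire function satisfying $I_m''(z)+\frac{1}{z}I_m'(z)-\left(\frac{m^2}{z^2}+1\right)I_m(z)=0$ and normalized by $I_m(z)=\frac{1}{m!}\left(\frac{z}{2}\right)^m+o(z^m)$ as $z\to 0$. The cross product $W_m$ is the entire function $W_m:=I_m'J_m-I_mJ_m'$. *)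

theory Defs
  imports "HOL-Complex_Analysis.Complex_Analysis"
begin

definition is_bessel_J :: "nat \<Rightarrow> (complex \<Rightarrow> complex) \<Rightarrow> bool" where
  "is_bessel_J m f \<longleftrightarrow>
     f holomorphic_on UNIV \<and>
     (\<forall>z. z \<noteq> 0 \<longrightarrow>
        deriv (deriv f) z + 1 / z * deriv f z - (of_nat m ^ 2 / z ^ 2 - 1) * f z = 0) \<and>
     (\<lambda>z. f z - 1 / fact m * (z / 2) ^ m) \<in> o[at 0](\<lambda>z. z ^ m)"

definition is_bessel_I :: "nat \<Rightarrow> (complex \<Rightarrow> complex) \<Rightarrow> bool" where
  "is_bessel_I m f \<longleftrightarrow>
     f holomorphic_on UNIV \<and>
     (\<forall>z. z \<noteq> 0 \<longrightarrow>
        deriv (deriv f) z + 1 / z * deriv f z - (of_nat m ^ 2 / z ^ 2 + 1) * f z = 0) \<and>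
     (\<lambda>z. f z - 1 / fact m * (z / 2) ^ m) \<in> o[at 0](\<lambda>z. z ^ m)"

text \<open>
  The descriptions below are proper: existence and uniqueness of the functions in
  question are \<open>ex1_bessel_J\<close> and \<open>ex1_bessel_I\<close> at the end of this theory.
\<close>

definition bessel_J :: "nat \<Rightarrow> complex \<Rightarrow> complex" where
  "bessel_J m = (THE f. is_bessel_J m f)"

definition bessel_I :: "nat \<Rightarrow> complex \<Rightarrow> complex" where
  "bessel_I m = (THE f. is_bessel_I m f)"

definition bessel_W :: "nat \<Rightarrow> complex \<Rightarrow> complex" where
  "bessel_W m z = deriv (bessel_I m) z * bessel_J m z - bessel_I m z * deriv (bessel_J m) z"


subsection \<open>Existence and uniqueness\<close>

lemma smallo_power_iff_fps:
  fixes h :: "complex \<Rightarrow> complex"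
  assumes H: "h has_fps_expansion H"
  shows "h \<in> o[at 0](\<lambda>z. z ^ m) \<longleftrightarrow> (\<forall>n\<le>m. fps_nth H n = 0)"
proof
  assume small: "h \<in> o[at 0](\<lambda>z. z ^ m)"
  show "\<forall>n\<le>m. fps_nth H n = 0"
  proof (rule ccontr)
    assume "\<not> (\<forall>n\<le>m. fps_nth H n = 0)"
    then obtain n where n: "n \<le> m" "fps_nth H n \<noteq> 0" by auto
    define d where "d = subdegree H"
    have "H \<noteq> 0" using n by auto
    hence c: "fps_nth H d \<noteq> 0" by (simp add: d_def)
    have "d \<le> n" unfolding d_def using n by (intro subdegree_leI)
    hence dm: "d \<le> m" using n by simp
    have "h \<sim>[nhds 0] (\<lambda>z. fps_nth H d * z ^ d)"
      unfolding d_def by (rule has_fps_expansion_imp_asymp_equiv_0[OF H])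
    hence "h \<sim>[at 0] (\<lambda>z. fps_nth H d * z ^ d)"
      by (simp add: asymp_equiv_nhds_iff)
    hence "h \<in> \<Theta>[at 0](\<lambda>z. fps_nth H d * z ^ d)"
      by (rule asymp_equiv_imp_bigtheta)
    hence th: "h \<in> \<Theta>[at 0](\<lambda>z. z ^ d)"
      using c by simp
    have "(\<lambda>z::complex. z ^ m) \<in> O[at 0](\<lambda>z. z ^ d)"
    proof (rule bigoI[of _ 1])
      show "\<forall>\<^sub>F z in at (0::complex). norm (z ^ m) \<le> 1 * norm (z ^ d)"
        unfolding eventually_at
        by (rule exI[of _ 1]) (auto simp: norm_power dm intro!: power_decreasing)
    qed
    with small have "h \<in> o[at 0](\<lambda>z. z ^ d)"
      by (rule landau_o.small_big_trans)
    hence "(\<lambda>z::complex. z ^ d) \<in> o[at 0](\<lambda>z. z ^ d)"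
      using th by (meson bigthetaD2 bigtheta_sym landau_o.big_small_trans bigthetaD1)
    hence "eventually (\<lambda>z::complex. z ^ d = 0) (at 0)"
      by (simp add: landau_o.small_refl_iff)
    moreover have "eventually (\<lambda>z::complex. z \<noteq> 0) (at 0)"
      by (rule eventually_neq_at_within)
    ultimately have "eventually (\<lambda>z::complex. False) (at 0)"
      by eventually_elim auto
    thus False by simp
  qed
next
  assume H0: "\<forall>n\<le>m. fps_nth H n = 0"
  define G where "G = fps_shift (Suc m) H"
  have eq: "H = fps_X ^ Suc m * G"
    unfolding G_def by (rule fps_ext) (use H0 in \<open>auto simp: fps_X_power_mult_nth simp del: power_Suc\<close>)
  have r: "fps_conv_radius G > 0"
    using H by (simp add: G_def has_fps_expansion_def)
  hence G: "eval_fps G has_fps_expansion G"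
    by (rule eval_fps_has_fps_expansion)
  have "(\<lambda>z. z ^ Suc m * eval_fps G z) has_fps_expansion H"
    unfolding eq by (intro fps_expansion_intros G)
  with H have ev: "eventually (\<lambda>z. h z = z ^ Suc m * eval_fps G z) (nhds 0)"
    unfolding has_fps_expansion_def by (auto elim: eventually_elim2)
  have "(eval_fps G \<longlongrightarrow> fps_nth G 0) (nhds 0)"
    by (rule has_fps_expansion_imp_tendsto_0[OF G])
  hence "(eval_fps G \<longlongrightarrow> fps_nth G 0) (at 0)"
    by (simp add: tendsto_nhds_iff)
  hence "((\<lambda>z. z * eval_fps G z) \<longlongrightarrow> 0 * fps_nth G 0) (at 0)"
    by (intro tendsto_intros)
  hence lim: "((\<lambda>z. z * eval_fps G z) \<longlongrightarrow> 0) (at 0)" by simp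
  have "((\<lambda>z. h z / z ^ m) \<longlongrightarrow> 0) (at 0)"
  proof (rule Lim_transform_eventually[OF lim])
    have "eventually (\<lambda>z. h z = z ^ Suc m * eval_fps G z) (at 0)"
      using ev by (simp add: eventually_nhds_conv_at)
    moreover have "eventually (\<lambda>z::complex. z \<noteq> 0) (at 0)"
      by (rule eventually_neq_at_within)
    ultimately show "eventually (\<lambda>z. z * eval_fps G z = h z / z ^ m) (at 0)"
      by eventually_elim auto
  qed
  thus "h \<in> o[at 0](\<lambda>z. z ^ m)"
  proof (rule smalloI_tendsto)
    show "eventually (\<lambda>z::complex. z ^ m \<noteq> 0) (at 0)"
      by (rule eventually_mono[OF eventually_neq_at_within[of 0]]) simp
  qed
qed

lemma bessel_ode_iff_fps:
  fixes f :: "complex \<Rightarrow> complex" and s :: complex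
  assumes f: "f holomorphic_on UNIV" and F: "f has_fps_expansion F"
  shows "(\<forall>z. z \<noteq> 0 \<longrightarrow>
            deriv (deriv f) z + 1 / z * deriv f z - (of_nat m ^ 2 / z ^ 2 - s) * f z = 0) \<longleftrightarrow>
         (\<forall>n. (of_nat n ^ 2 - of_nat m ^ 2) * fps_nth F n +
              s * (if n < 2 then 0 else fps_nth F (n - 2)) = 0)"
    (is "?ode \<longleftrightarrow> ?rec")
proof -
  define g where "g = (\<lambda>z. z ^ 2 * deriv (deriv f) z + z ^ 1 * deriv f z +
                           s * (z ^ 2 * f z) - of_nat m ^ 2 * f z)"
  define P where "P = fps_X ^ 2 * fps_deriv (fps_deriv F) + fps_X ^ 1 * fps_deriv F +
                      fps_const s * (fps_X ^ 2 * F) - fps_const (of_nat m ^ 2) * F"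
  have gP: "g has_fps_expansion P"
    unfolding g_def P_def by (intro fps_expansion_intros F)
  have g: "g holomorphic_on UNIV"
    unfolding g_def by (intro holomorphic_intros f) auto
  have ode: "?ode \<longleftrightarrow> (\<forall>z. z \<noteq> 0 \<longrightarrow> g z = 0)"
  proof -
    have "deriv (deriv f) z + 1 / z * deriv f z - (of_nat m ^ 2 / z ^ 2 - s) * f z = g z / z ^ 2"
      if "z \<noteq> 0" for z
      using that by (simp add: g_def field_simps power2_eq_square)
    thus ?thesis by auto
  qed
  also have "\<dots> \<longleftrightarrow> P = 0"
  proof
    assume *: "\<forall>z. z \<noteq> 0 \<longrightarrow> g z = 0"
    have "\<forall>n\<le>k. fps_nth P n = 0" for k
    proof -
      have "g \<in> o[at 0](\<lambda>z. z ^ k) \<longleftrightarrow> (\<lambda>_. 0) \<in> o[at 0](\<lambda>z::complex. z ^ k)"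
        by (rule landau_o.small.in_cong) (auto simp: eventually_at * intro!: exI[of _ 1])
      thus ?thesis using smallo_power_iff_fps[OF gP, of k] by simp
    qed
    thus "P = 0" by (intro fps_ext) auto
  next
    assume "P = 0"
    thus "\<forall>z. z \<noteq> 0 \<longrightarrow> g z = 0"
      using has_fps_expansion_0_analytic_continuation[of g UNIV] gP g by auto
  qed
  also have "\<dots> \<longleftrightarrow> ?rec"
  proof -
    have "fps_nth P n = (of_nat n ^ 2 - of_nat m ^ 2) * fps_nth F n +
              s * (if n < 2 then 0 else fps_nth F (n - 2))" for n
    proof -
      consider "n = 0" | "n = 1" | k where "n = k + 2"
        by (metis One_nat_def add_2_eq_Suc' not0_implies_Suc)
      thus ?thesis
        by cases (simp_all add: P_def fps_X_power_mult_nth del: power_Suc,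
                  simp_all add: algebra_simps power2_eq_square)
    qed
    thus ?thesis by (auto simp: fps_eq_iff)
  qed
  finally show ?thesis .
qed

lemma bessel_norm_iff_fps:
  fixes f :: "complex \<Rightarrow> complex"
  assumes F: "f has_fps_expansion F"
  shows "(\<lambda>z. f z - 1 / fact m * (z / 2) ^ m) \<in> o[at 0](\<lambda>z. z ^ m) \<longleftrightarrow>
         (\<forall>n\<le>m. fps_nth F n = (if n = m then 1 / (fact m * 2 ^ m) else 0))"
proof -
  define H where "H = F - fps_const (1 / (fact m * 2 ^ m)) * fps_X ^ m"
  have "(\<lambda>z. f z - 1 / (fact m * 2 ^ m) * z ^ m) has_fps_expansion H"
    unfolding H_def by (intro fps_expansion_intros F)
  also have "(\<lambda>z. f z - 1 / (fact m * 2 ^ m) * z ^ m) = (\<lambda>z. f z - 1 / fact m * (z / 2) ^ m)"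
    by (simp add: power_divide)
  finally show ?thesis
    by (subst smallo_power_iff_fps) (auto simp: H_def)
qed

lemma ex1_bessel_aux:
  fixes s :: complex
  assumes s: "norm s = 1"
  shows "\<exists>!f. f holomorphic_on UNIV \<and>
     (\<forall>z. z \<noteq> 0 \<longrightarrow>
        deriv (deriv f) z + 1 / z * deriv f z - (of_nat m ^ 2 / z ^ 2 - s) * f z = 0) \<and>
     (\<lambda>z. f z - 1 / fact m * (z / 2) ^ m) \<in> o[at 0](\<lambda>z. z ^ m)"
    (is "\<exists>!f. ?P f")
proof -
  define Q where "Q = (\<lambda>F :: complex fps.
    (\<forall>n. (of_nat n ^ 2 - of_nat m ^ 2) * fps_nth F n +
              s * (if n < 2 then 0 else fps_nth F (n - 2)) = 0) \<and>
    (\<forall>n\<le>m. fps_nth F n = (if n = m then 1 / (fact m * 2 ^ m) else 0)))"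
  have P_iff: "?P f \<longleftrightarrow> Q F" if "f holomorphic_on UNIV" "f has_fps_expansion F" for f F
    using bessel_ode_iff_fps[OF that, of m s] bessel_norm_iff_fps[OF that(2), of m] that(1)
    by (simp add: Q_def)
  have Q_unique: "F = G" if "Q F" "Q G" for F G
  proof (rule fps_ext)
    fix n show "fps_nth F n = fps_nth G n"
    proof (induction n rule: less_induct)
      case (less n)
      show ?case
      proof (cases "n \<le> m")
        case True
        thus ?thesis using that by (simp add: Q_def)
      next
        case False
        let ?r = "\<lambda>F. s * (if n < 2 then 0 else fps_nth F (n - 2))"
        have eq: "?r F = ?r G" using less[of "n - 2"] by auto
        have "(of_nat n ^ 2 - of_nat m ^ 2) * fps_nth F n + ?r F = 0"
             "(of_nat n ^ 2 - of_nat m ^ 2) * fps_nth G n + ?r G = 0"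
          using that unfolding Q_def by blast+
        with eq have *: "(of_nat n ^ 2 - of_nat m ^ 2 :: complex) * fps_nth F n =
              (of_nat n ^ 2 - of_nat m ^ 2) * fps_nth G n"
          by (metis add_right_cancel)
        have "n ^ 2 \<noteq> m ^ 2" using False by simp
        hence "(of_nat (n ^ 2) :: complex) \<noteq> of_nat (m ^ 2)"
          by (simp only: of_nat_eq_iff not_False_eq_True)
        with * show ?thesis by simp
      qed
    qed
  qed

  define c :: "nat \<Rightarrow> complex" where "c = (\<lambda>n. if n \<ge> m \<and> even (n - m) then
     (-s) ^ ((n - m) div 2) / (fact ((n - m) div 2) * fact (m + (n - m) div 2) * 2 ^ n) else 0)"
  define F where "F = Abs_fps c"
  have c_shift: "c (m + 2 * k) = (-s) ^ k / (fact k * fact (m + k) * 2 ^ (m + 2 * k))" for k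
    by (simp add: c_def)
  have c_cases: "(\<exists>k. n = m + 2 * k) \<or> (c n = 0 \<and> (n \<ge> 2 \<longrightarrow> c (n - 2) = 0))" for n
  proof (cases "n \<ge> m \<and> even (n - m)")
    case True
    then obtain k where "n - m = 2 * k" by (metis evenE)
    hence "n = m + 2 * k" using True by linarith
    thus ?thesis by blast
  next
    case False
    have "\<not> (n - 2 \<ge> m \<and> even (n - 2 - m))" if "n \<ge> 2"
    proof
      assume *: "n - 2 \<ge> m \<and> even (n - 2 - m)"
      hence "n - m = (n - 2 - m) + 2" using that by linarith
      hence "even (n - m)" using * by simp
      with False * show False by auto
    qed
    thus ?thesis using False by (auto simp: c_def)
  qed
  have "Q F"
    unfolding Q_def
  proof (intro conjI allI impI)
    fix n
    show "(of_nat n ^ 2 - of_nat m ^ 2) * fps_nth F n +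
              s * (if n < 2 then 0 else fps_nth F (n - 2)) = 0"
    proof (cases "\<exists>k. n = m + 2 * k")
      case False
      thus ?thesis using c_cases[of n] by (auto simp: F_def)
    next
      case True
      then obtain k where n: "n = m + 2 * k" ..
      show ?thesis
      proof (cases k)
        case 0
        thus ?thesis using n by (auto simp: F_def c_def)
      next
        case (Suc j)
        have n2: "n - 2 = m + 2 * j" "\<not> n < 2" using n Suc by auto
        have sq: "(of_nat n ^ 2 - of_nat m ^ 2 :: complex) =
                    4 * of_nat (Suc j) * of_nat (Suc (m + j))"
          by (simp add: n Suc power2_eq_square algebra_simps)
        have cn: "c n = (-s) * (-s) ^ j /
           ((of_nat (Suc j) * fact j) * (of_nat (Suc (m + j)) * fact (m + j)) * (4 * 2 ^ (m + 2 * j)))"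
          unfolding n Suc c_shift by (simp add: algebra_simps)
        have nz: "(of_nat (Suc j) :: complex) \<noteq> 0" "(of_nat (Suc (m + j)) :: complex) \<noteq> 0"
          by (simp_all only: of_nat_eq_0_iff nat.distinct not_False_eq_True)
        have "a * b * 4 * ((-s) * x / ((a * u) * (b * v) * (4 * w))) + s * (x / (u * v * w)) = 0"
          if "a \<noteq> 0" "b \<noteq> 0" for a b x u v w :: complex
          using that by (cases "u = 0 \<or> v = 0 \<or> w = 0") (auto simp: field_simps)
        from this[OF nz] show ?thesis
          using n2 by (simp add: F_def sq cn c_shift[unfolded mult.commute[of 2]] mult_ac del: of_nat_Suc)
      qed
    qed
  next
    fix n assume "n \<le> m"
    thus "fps_nth F n = (if n = m then 1 / (fact m * 2 ^ m) else 0)"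
      by (auto simp: F_def c_def)
  qed
  have c_bound: "norm (c n) \<le> 1 / fact n" for n
  proof (cases "\<exists>k. n = m + 2 * k")
    case False
    thus ?thesis using c_cases[of n] by auto
  next
    case True
    then obtain k where n: "n = m + 2 * k" ..
    have "fact k * fact (n - k) * (n choose k) = (fact n :: nat)"
      by (rule binomial_fact_lemma) (simp add: n)
    moreover have "n - k = m + k" by (simp add: n)
    ultimately have "(fact n :: nat) \<le> fact k * fact (m + k) * 2 ^ n"
      using binomial_le_pow2[of n k] by (metis mult_le_mono2)
    hence "(of_nat (fact n) :: real) \<le> of_nat (fact k * fact (m + k) * 2 ^ n)"
      by (simp only: of_nat_le_iff)
    hence "(fact n :: real) \<le> fact k * fact (m + k) * 2 ^ n" by simp
    moreover have "norm (c n) = 1 / (fact k * fact (m + k) * 2 ^ n)"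
      unfolding n c_shift by (simp add: norm_divide norm_mult norm_power s)
    ultimately show ?thesis by (simp add: frac_le)
  qed
  have "fps_conv_radius F = \<infinity>"
    unfolding fps_conv_radius_def
  proof (rule conv_radius_inftyI'')
    fix z :: complex
    show "summable (\<lambda>n. fps_nth F n * z ^ n)"
    proof (rule summable_comparison_test')
      show "summable (\<lambda>n. norm z ^ n /\<^sub>R fact n)"
        by (rule summable_exp_generic)
      show "norm (fps_nth F n * z ^ n) \<le> norm z ^ n /\<^sub>R fact n" if "n \<ge> 0" for n
        using mult_right_mono[OF c_bound[of n], of "norm z ^ n"]
        by (simp add: F_def norm_mult norm_power divide_inverse)
    qed
  qed
  hence hol: "eval_fps F holomorphic_on UNIV" and exp: "eval_fps F has_fps_expansion F"
    by (auto intro!: holomorphic_on_eval_fps eval_fps_has_fps_expansion)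
  show ?thesis
  proof (rule ex1I[of _ "eval_fps F"])
    show "?P (eval_fps F)" using P_iff[OF hol exp] \<open>Q F\<close> by blast
  next
    fix f assume f: "?P f"
    hence f_hol: "f holomorphic_on UNIV" by blast
    hence f_exp: "f has_fps_expansion fps_expansion f 0"
      by (intro has_fps_expansion_fps_expansion[of UNIV]) auto
    have "Q (fps_expansion f 0)" using P_iff[OF f_hol f_exp] f by blast
    hence eq: "fps_expansion f 0 = F" using \<open>Q F\<close> by (rule Q_unique)
    show "f = eval_fps F"
    proof
      fix z
      have "eval_fps (fps_expansion f 0) z = f z"
        by (rule has_fps_expansion_imp_eval_fps_eq[OF f_exp, of z "norm z + 1"])
           (auto intro: holomorphic_on_subset[OF f_hol])
      thus "f z = eval_fps F z" by (simp add: eq)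
    qed
  qed
qed

lemma ex1_bessel_J: "\<exists>!f. is_bessel_J m f"
  using ex1_bessel_aux[of 1 m] by (simp add: is_bessel_J_def)

lemma ex1_bessel_I: "\<exists>!f. is_bessel_I m f"
  using ex1_bessel_aux[of "-1" m] by (simp add: is_bessel_I_def)

lemma is_bessel_J_bessel_J: "is_bessel_J m (bessel_J m)"
  unfolding bessel_J_def by (rule theI'[OF ex1_bessel_J])

lemma is_bessel_I_bessel_I: "is_bessel_I m (bessel_I m)"
  unfolding bessel_I_def by (rule theI'[OF ex1_bessel_I])

end

theory Submission
  imports Defs
begin

text \<open>
  Everything rests on the ladder relations
  \<open>f\<^sub>m' = (m/z) f\<^sub>m - s f\<^sub>m\<^sub>+\<^sub>1\<close> and
  \<open>f\<^sub>m\<^sub>+\<^sub>1' = f\<^sub>m - ((m+1)/z) f\<^sub>m\<^sub>+\<^sub>1\<close>,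
  valid for \<open>J\<close> with \<open>s = 1\<close> and for \<open>I\<close> with \<open>s = -1\<close>. They are obtained by comparing Taylor
  coefficients, since the differential equation is a two-step recursion for these coefficients
  and the normalization supplies its initial values.

  The ladder relations remove the derivatives from the cross product: both
  \<open>W\<^sub>k = I\<^sub>k\<^sub>+\<^sub>1 J\<^sub>k + I\<^sub>k J\<^sub>k\<^sub>+\<^sub>1\<close> and
  \<open>W\<^sub>k\<^sub>+\<^sub>1 = I\<^sub>k J\<^sub>k\<^sub>+\<^sub>1 - I\<^sub>k\<^sub>+\<^sub>1 J\<^sub>k\<close> hold. Hence sums and differences of neighbouring
  cross products are single products such as \<open>W\<^sub>k + W\<^sub>k\<^sub>+\<^sub>1 = 2 I\<^sub>k J\<^sub>k\<^sub>+\<^sub>1\<close>.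
  Writing \<open>P\<^sub>k = I\<^sub>k J\<^sub>k\<close> and using the three-term recurrences
  \<open>J\<^sub>k\<^sub>-\<^sub>1 + J\<^sub>k\<^sub>+\<^sub>1 = (2k/z) J\<^sub>k\<close> and \<open>I\<^sub>k\<^sub>-\<^sub>1 - I\<^sub>k\<^sub>+\<^sub>1 = (2k/z) I\<^sub>k\<close>, one gets
  \<open>W\<^sub>k\<^sub>-\<^sub>1 + W\<^sub>k\<^sub>+\<^sub>1 = (4k/z) P\<^sub>k\<close> and \<open>P\<^sub>k\<^sub>-\<^sub>1 + P\<^sub>k\<^sub>+\<^sub>1 = (k/z) (W\<^sub>k\<^sub>-\<^sub>1 - W\<^sub>k\<^sub>+\<^sub>1)\<close>.
  The second identity at \<open>k = m + 2\<close>, with \<open>P\<^sub>m\<^sub>+\<^sub>1\<close> and \<open>P\<^sub>m\<^sub>+\<^sub>3\<close> rewritten by the first,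
  is the claimed recursion.
\<close>

section \<open>Taylor coefficients\<close>

text \<open>
  The sign \<open>s\<close> makes one development serve both families: \<open>s = 1\<close> gives the Bessel
  functions and \<open>s = -1\<close> the modified ones.
\<close>

definition is_signed_bessel :: "complex \<Rightarrow> nat \<Rightarrow> (complex \<Rightarrow> complex) \<Rightarrow> bool" where
  "is_signed_bessel s m f \<longleftrightarrow>
     f holomorphic_on UNIV \<and>
     (\<forall>z. z \<noteq> 0 \<longrightarrow>
        deriv (deriv f) z + 1 / z * deriv f z - (of_nat m ^ 2 / z ^ 2 - s) * f z = 0) \<and>
     (\<lambda>z. f z - 1 / fact m * (z / 2) ^ m) \<in> o[at 0](\<lambda>z. z ^ m)"

definition bessel_coeffs :: "complex \<Rightarrow> nat \<Rightarrow> complex fps \<Rightarrow> bool" where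
  "bessel_coeffs s m F \<longleftrightarrow>
     (\<forall>n. (of_nat n ^ 2 - of_nat m ^ 2) * fps_nth F n +
          s * (if n < 2 then 0 else fps_nth F (n - 2)) = 0) \<and>
     (\<forall>n\<le>m. fps_nth F n = (if n = m then 1 / (fact m * 2 ^ m) else 0))"

lemma bessel_coeffs_recursion:
  assumes "bessel_coeffs s m F"
  shows "(of_nat n + of_nat m + 2) * (of_nat n + 2 - of_nat m) * fps_nth F (n + 2)
           = - s * fps_nth F n"
proof -
  have "(of_nat (n + 2) ^ 2 - of_nat m ^ 2) * fps_nth F (n + 2) + s * fps_nth F n = 0"
    using conjunct1[OF assms[unfolded bessel_coeffs_def], rule_format, of "n + 2"] by simp
  thus ?thesis by (simp add: algebra_simps power2_eq_square add_eq_0_iff)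
qed

lemma bessel_coeffs_init:
  assumes "bessel_coeffs s m F" "n \<le> m"
  shows "fps_nth F n = (if n = m then 1 / (fact m * 2 ^ m) else 0)"
  using assms by (simp add: bessel_coeffs_def)

lemma bessel_coeffs_1:
  assumes "bessel_coeffs s m F" "m \<noteq> 1"
  shows "fps_nth F 1 = 0"
proof (cases "m = 0")
  case True
  thus ?thesis using assms(1) unfolding bessel_coeffs_def
    by (auto dest!: spec[of _ 1])
next
  case False
  thus ?thesis using bessel_coeffs_init[OF assms(1), of 1] assms(2) by simp
qed

text \<open>
  Both sides satisfy the same two-step recursion in \<open>n\<close>, whose leading factor does not vanish
  for \<open>n > m\<close>; up to \<open>n = m\<close> the normalizations match.
\<close>

lemma bessel_coeffs_raise:
  assumes F: "bessel_coeffs s m F" and G: "bessel_coeffs s (Suc m) G"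
  shows "(of_nat n + of_nat m + 2) * fps_nth G (Suc n) = fps_nth F n"
proof (induction n rule: less_induct)
  case (less n)
  consider "n < m" | "n = m" | "n = 1" "m = 0" | k where "n = k + 2" "n > m"
  proof (cases "n \<le> m \<or> n = 1")
    case True
    thus ?thesis using that(1-3) by force
  next
    case False
    hence "n = (n - 2) + 2" "n > m" by auto
    thus ?thesis by (rule that(4))
  qed
  thus ?case
  proof cases
    case 1
    thus ?thesis using bessel_coeffs_init[OF F, of n] bessel_coeffs_init[OF G, of "Suc n"] by simp
  next
    case 2
    have "(of_nat m + 1 :: complex) \<noteq> 0"
      using of_nat_neq_0[of m, where 'a = complex] by (simp add: add.commute)
    moreover have "fps_nth G (Suc n) = 1 / ((of_nat m + 1) * fact m * (2 * 2 ^ m))"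
      using 2 bessel_coeffs_init[OF G, of "Suc n"] by (simp add: algebra_simps)
    moreover have "(of_nat n + of_nat m + 2 :: complex) = 2 * (of_nat m + 1)"
      using 2 by simp
    moreover have "2 * a * (1 / (a * b * (2 * c))) = 1 / (b * c)"
      if "a \<noteq> 0" for a b c :: complex
      using that by simp
    ultimately show ?thesis
      using 2 bessel_coeffs_init[OF F, of n] by (simp del: distrib_left_numeral)
  next
    case 3
    have "fps_nth G 0 = 0" using bessel_coeffs_init[OF G, of 0] by simp
    thus ?thesis using 3 bessel_coeffs_1[OF F] bessel_coeffs_recursion[OF G, of 0] by (simp add: numeral_2_eq_2)
  next
    case 4
    define N :: complex where "N = of_nat k"
    define M :: complex where "M = of_nat m"
    have nz: "N + 2 - M \<noteq> 0" "N + M + 2 \<noteq> 0"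
    proof -
      have "N + 2 - M = of_nat (k + 2 - m)"
        using 4 by (simp add: N_def M_def of_nat_diff)
      thus "N + 2 - M \<noteq> 0" using 4 by (simp only: of_nat_eq_0_iff)
      have "N + M + 2 = of_nat (k + m + 2)" by (simp add: N_def M_def)
      thus "N + M + 2 \<noteq> 0" by (simp only: of_nat_eq_0_iff)
    qed
    have IH: "(N + M + 2) * fps_nth G (Suc k) = fps_nth F k"
      using less[of k] 4 by (simp add: N_def M_def)
    have f: "(N + M + 2) * (N + 2 - M) * fps_nth F n = - s * fps_nth F k"
      using bessel_coeffs_recursion[OF F, of k] 4 by (simp add: N_def M_def)
    have g: "(N + M + 4) * (N + 2 - M) * fps_nth G (Suc n) = - s * fps_nth G (Suc k)"
      using bessel_coeffs_recursion[OF G, of "Suc k"] 4 by (simp add: N_def M_def algebra_simps)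
    have "(N + M + 2) * (N + 2 - M) * ((N + M + 4) * fps_nth G (Suc n)) =
            (N + M + 2) * ((N + M + 4) * (N + 2 - M) * fps_nth G (Suc n))"
      by (simp only: mult_ac)
    also have "\<dots> = - s * ((N + M + 2) * fps_nth G (Suc k))"
      unfolding g by (simp only: mult_ac)
    also have "\<dots> = (N + M + 2) * (N + 2 - M) * fps_nth F n"
      unfolding IH f ..
    finally have "(N + M + 4) * fps_nth G (Suc n) = fps_nth F n"
      using nz by simp
    thus ?thesis using 4 by (simp add: N_def M_def algebra_simps)
  qed
qed

text \<open>
  The leading coefficient of the recursion for \<open>F\<close> is a difference of squares, and the raising
  relation contributes precisely its factor that never vanishes, so that factor cancels.
\<close>

lemma bessel_coeffs_lower:
  assumes F: "bessel_coeffs s m F" and G: "bessel_coeffs s (Suc m) G"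
  shows "(of_nat n + 1 - of_nat m) * fps_nth F (Suc n) = - s * fps_nth G n"
proof (cases n)
  case 0
  have "fps_nth G 0 = 0" using bessel_coeffs_init[OF G, of 0] by simp
  thus ?thesis using 0 bessel_coeffs_1[OF F] by (cases "m = 1") auto
next
  case (Suc k)
  define A :: complex where "A = of_nat k + of_nat m + 2"
  have "A = of_nat (k + m + 2)" by (simp add: A_def)
  hence "A \<noteq> 0" by (simp only: of_nat_eq_0_iff)
  moreover have "A * ((of_nat k + 2 - of_nat m) * fps_nth F (Suc n)) = A * (- s * fps_nth G n)"
    using bessel_coeffs_recursion[OF F, of k] bessel_coeffs_raise[OF F G, of k] Suc
    by (simp add: A_def mult_ac)
  ultimately have "(of_nat k + 2 - of_nat m) * fps_nth F (Suc n) = - s * fps_nth G n"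
    using mult_left_cancel by blast
  thus ?thesis using Suc by (simp add: add_ac)
qed

lemma is_signed_bessel_coeffs:
  assumes "is_signed_bessel s m f" "f has_fps_expansion F"
  shows "bessel_coeffs s m F"
  using assms bessel_ode_iff_fps[of f F m s] bessel_norm_iff_fps[of f F m]
  by (simp add: is_signed_bessel_def bessel_coeffs_def)

section \<open>Ladder relations and three-term recurrences\<close>

lemma entire_eq_0_if_fps_eq_0:
  assumes "h holomorphic_on UNIV" "h has_fps_expansion H" "\<And>n. fps_nth H n = 0"
  shows "h z = 0"
proof -
  have "H = 0" using assms(3) by (intro fps_ext) simp
  thus ?thesis
    using has_fps_expansion_0_analytic_continuation[of h UNIV] assms(1,2) by auto
qed

text \<open>
  Multiplied by \<open>z\<close>, the ladder relations are identities between entire functions, so it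
  suffices to match Taylor coefficients at \<open>0\<close>.
\<close>

lemma signed_bessel_ladder:
  assumes f: "is_signed_bessel s m f" and g: "is_signed_bessel s (Suc m) g"
  shows "z * deriv f z = of_nat m * f z - s * z * g z"
    and "z * deriv g z = z * f z - (of_nat m + 1) * g z"
proof -
  define F where "F = fps_expansion f 0"
  define G where "G = fps_expansion g 0"
  have hol: "f holomorphic_on UNIV" "g holomorphic_on UNIV"
    using f g by (auto simp: is_signed_bessel_def)
  have exp: "f has_fps_expansion F" "g has_fps_expansion G"
    unfolding F_def G_def using hol
    by (auto intro!: has_fps_expansion_fps_expansion[of UNIV])
  have FG: "bessel_coeffs s m F" "bessel_coeffs s (Suc m) G"
    using is_signed_bessel_coeffs[OF f exp(1)] is_signed_bessel_coeffs[OF g exp(2)] .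
  have init: "of_nat m * fps_nth F 0 = 0" "fps_nth G 0 = 0"
    using bessel_coeffs_init[OF FG(1), of 0] bessel_coeffs_init[OF FG(2), of 0] by auto

  define h where "h = (\<lambda>z. z * deriv f z - of_nat m * f z + s * (z * g z))"
  define H where "H = fps_X * fps_deriv F - fps_const (of_nat m) * F + fps_const s * (fps_X * G)"
  have "h has_fps_expansion H"
    unfolding h_def H_def by (intro fps_expansion_intros exp)
  moreover have "h holomorphic_on UNIV"
    unfolding h_def by (intro holomorphic_intros hol) auto
  moreover have "fps_nth H n = 0" for n
    using bessel_coeffs_lower[OF FG, of "n - 1"] init
    by (cases n) (auto simp: H_def algebra_simps)
  ultimately have "h z = 0" using entire_eq_0_if_fps_eq_0 by blast
  thus "z * deriv f z = of_nat m * f z - s * z * g z"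
    by (simp add: h_def algebra_simps add_eq_0_iff)

  define k where "k = (\<lambda>z. z * deriv g z - z * f z + (of_nat m + 1) * g z)"
  define K where "K = fps_X * fps_deriv G - fps_X * F + fps_const (of_nat m + 1) * G"
  have "k has_fps_expansion K"
    unfolding k_def K_def by (intro fps_expansion_intros exp)
  moreover have "k holomorphic_on UNIV"
    unfolding k_def by (intro holomorphic_intros hol) auto
  moreover have "fps_nth K n = 0" for n
    using bessel_coeffs_raise[OF FG, of "n - 1"] init
    by (cases n) (auto simp: K_def algebra_simps)
  ultimately have "k z = 0" using entire_eq_0_if_fps_eq_0 by blast
  thus "z * deriv g z = z * f z - (of_nat m + 1) * g z"
    by (simp add: k_def algebra_simps add_eq_0_iff)
qed

lemma is_signed_bessel_J: "is_signed_bessel 1 m (bessel_J m)"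
  using is_bessel_J_bessel_J[of m] by (simp add: is_signed_bessel_def is_bessel_J_def)

lemma is_signed_bessel_I: "is_signed_bessel (-1) m (bessel_I m)"
  using is_bessel_I_bessel_I[of m] by (simp add: is_signed_bessel_def is_bessel_I_def)

lemmas bessel_J_ladder = signed_bessel_ladder[OF is_signed_bessel_J is_signed_bessel_J]
lemmas bessel_I_ladder = signed_bessel_ladder[OF is_signed_bessel_I is_signed_bessel_I]

text \<open>Both recurrences arise by equating the two ladder expressions for the middle derivative.\<close>

lemma bessel_J_three_term:
  "z * (bessel_J m z + bessel_J (Suc (Suc m)) z) = 2 * (of_nat m + 1) * bessel_J (Suc m) z"
  using bessel_J_ladder(2)[of z m] bessel_J_ladder(1)[of z "Suc m"] by (simp add: algebra_simps)

lemma bessel_I_three_term: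
  "z * (bessel_I m z - bessel_I (Suc (Suc m)) z) = 2 * (of_nat m + 1) * bessel_I (Suc m) z"
  using bessel_I_ladder(2)[of z m] bessel_I_ladder(1)[of z "Suc m"] by (simp add: algebra_simps)

section \<open>Cross products\<close>

lemma times_bessel_W:
  "z * bessel_W m z =
     (z * deriv (bessel_I m) z) * bessel_J m z - bessel_I m z * (z * deriv (bessel_J m) z)"
  by (simp add: bessel_W_def algebra_simps)

text \<open>
  Each cross product has two derivative-free forms, one through the next index and one through
  the previous index. Having both for neighbouring cross products over the same pair of
  indices is what makes their sums and differences collapse to a single product.
\<close>

lemma bessel_W_eq:
  assumes "z \<noteq> 0"
  shows "bessel_W m z = bessel_I (Suc m) z * bessel_J m z + bessel_I m z * bessel_J (Suc m) z"
proof -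
  have "z * bessel_W m z =
          z * (bessel_I (Suc m) z * bessel_J m z + bessel_I m z * bessel_J (Suc m) z)"
    unfolding times_bessel_W bessel_I_ladder(1) bessel_J_ladder(1) by (simp add: algebra_simps)
  thus ?thesis using assms by simp
qed

lemma bessel_W_Suc_eq:
  assumes "z \<noteq> 0"
  shows "bessel_W (Suc m) z
           = bessel_I m z * bessel_J (Suc m) z - bessel_I (Suc m) z * bessel_J m z"
proof -
  have "z * bessel_W (Suc m) z =
          z * (bessel_I m z * bessel_J (Suc m) z - bessel_I (Suc m) z * bessel_J m z)"
    unfolding times_bessel_W bessel_I_ladder(2) bessel_J_ladder(2) by (simp add: algebra_simps)
  thus ?thesis using assms by simp
qed

text \<open>
  Inserting \<open>W\<^sub>m\<^sub>+\<^sub>1\<close> with opposite signs collapses the sum to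
  \<open>2 I\<^sub>m\<^sub>+\<^sub>1 J\<^sub>m + 2 I\<^sub>m\<^sub>+\<^sub>1 J\<^sub>m\<^sub>+\<^sub>2\<close>, to which the recurrence for \<open>J\<close> applies.
\<close>

lemma bessel_W_add_W:
  assumes "z \<noteq> 0"
  shows "z * (bessel_W m z + bessel_W (Suc (Suc m)) z)
           = 4 * (of_nat m + 1) * (bessel_I (Suc m) z * bessel_J (Suc m) z)"
proof -
  have "bessel_W m z - bessel_W (Suc m) z = 2 * bessel_I (Suc m) z * bessel_J m z"
    by (simp add: bessel_W_eq[OF assms, of m] bessel_W_Suc_eq[OF assms, of m])
  moreover have "bessel_W (Suc m) z + bessel_W (Suc (Suc m)) z
                   = 2 * bessel_I (Suc m) z * bessel_J (Suc (Suc m)) z"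
    by (simp add: bessel_W_eq[OF assms, of "Suc m"] bessel_W_Suc_eq[OF assms, of "Suc m"])
  ultimately have "z * (bessel_W m z + bessel_W (Suc (Suc m)) z)
      = 2 * bessel_I (Suc m) z * (z * (bessel_J m z + bessel_J (Suc (Suc m)) z))"
    by algebra
  thus ?thesis
    by (simp add: bessel_J_three_term mult_ac)
qed

text \<open>
  Here the difference telescopes to \<open>2 I\<^sub>m\<^sub>+\<^sub>1 J\<^sub>m + 2 I\<^sub>m\<^sub>+\<^sub>2 J\<^sub>m\<^sub>+\<^sub>1\<close>. Expanding
  \<open>I\<^sub>m\<^sub>+\<^sub>1\<close> in the first product and \<open>J\<^sub>m\<^sub>+\<^sub>1\<close> in the second by their recurrences, the mixed
  terms \<open>I\<^sub>m\<^sub>+\<^sub>2 J\<^sub>m\<close> cancel.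
\<close>

lemma bessel_W_diff_W:
  assumes "z \<noteq> 0"
  shows "(of_nat m + 1) * (bessel_W m z - bessel_W (Suc (Suc m)) z)
           = z * (bessel_I m z * bessel_J m z
                  + bessel_I (Suc (Suc m)) z * bessel_J (Suc (Suc m)) z)"
proof -
  have "bessel_W m z - bessel_W (Suc m) z = 2 * bessel_I (Suc m) z * bessel_J m z"
    by (simp add: bessel_W_eq[OF assms, of m] bessel_W_Suc_eq[OF assms, of m])
  moreover have "bessel_W (Suc m) z - bessel_W (Suc (Suc m)) z
                   = 2 * bessel_I (Suc (Suc m)) z * bessel_J (Suc m) z"
    by (simp add: bessel_W_eq[OF assms, of "Suc m"] bessel_W_Suc_eq[OF assms, of "Suc m"])
  ultimately have "(of_nat m + 1) * (bessel_W m z - bessel_W (Suc (Suc m)) z)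
      = 2 * (of_nat m + 1) * bessel_I (Suc m) z * bessel_J m z
        + bessel_I (Suc (Suc m)) z * (2 * (of_nat m + 1) * bessel_J (Suc m) z)"
    by algebra
  thus ?thesis
    unfolding bessel_J_three_term[symmetric] bessel_I_three_term[symmetric]
    by (simp add: algebra_simps)
qed

theorem theorem3p1:
  fixes m :: nat and z :: complex
  assumes "z \<noteq> 0"
  shows "bessel_W (m + 2) z + bessel_W (m + 4) z =
           4 * (of_nat m + 2) * (of_nat m + 3) / z ^ 2 *
             (bessel_W (m + 1) z - bessel_W (m + 3) z)
           - (of_nat m + 3) / (of_nat m + 1) * (bessel_W m z + bessel_W (m + 2) z)"
proof -
  have index: "m + 1 = Suc m" "m + 2 = Suc (Suc m)" "m + 3 = Suc (Suc (Suc m))"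
    "m + 4 = Suc (Suc (Suc (Suc m)))" by simp_all
  define M :: complex where "M = of_nat m"
  define P where "P = (\<lambda>k. bessel_I k z * bessel_J k z)"
  have nz: "M + 1 \<noteq> 0" unfolding M_def
    using of_nat_neq_0[of m, where 'a = complex] by (simp add: add.commute)
  have lo: "bessel_W m z + bessel_W (m + 2) z = 4 * (M + 1) / z * P (m + 1)"
    using bessel_W_add_W[OF assms, of m] assms unfolding index by (simp add: P_def M_def field_simps)
  have hi: "bessel_W (m + 2) z + bessel_W (m + 4) z = 4 * (M + 3) / z * P (m + 3)"
    using bessel_W_add_W[OF assms, of "m + 2"] assms unfolding index
    by (simp add: P_def M_def field_simps)
  have mid: "(M + 2) * (bessel_W (m + 1) z - bessel_W (m + 3) z) = z * (P (m + 1) + P (m + 3))"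
    using bessel_W_diff_W[OF assms, of "m + 1"] unfolding index by (simp add: P_def M_def algebra_simps)
  have "4 * (M + 2) * (M + 3) / z ^ 2 * (bessel_W (m + 1) z - bessel_W (m + 3) z)
          = 4 * (M + 3) / z ^ 2 * ((M + 2) * (bessel_W (m + 1) z - bessel_W (m + 3) z))"
    by (simp only: times_divide_eq_left times_divide_eq_right mult_ac)
  also have "\<dots> = 4 * (M + 3) / z * (P (m + 1) + P (m + 3))"
    unfolding mid using assms by (simp add: power2_eq_square)
  finally have right: "4 * (M + 2) * (M + 3) / z ^ 2 * (bessel_W (m + 1) z - bessel_W (m + 3) z)
          = 4 * (M + 3) / z * (P (m + 1) + P (m + 3))" .
  have "(M + 3) / (M + 1) * (bessel_W m z + bessel_W (m + 2) z) = 4 * (M + 3) / z * P (m + 1)"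
    unfolding lo using nz assms by (simp add: divide_simps) (simp add: algebra_simps)
  thus ?thesis
    unfolding M_def[symmetric] hi right by (simp add: ring_distribs)
qed

end
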